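(* Let $F$ be a connected graph with $\ell$ vertices. If $F$ has a pendant sparkler subgraph, then $W'(F)\ge \ell-\mathrm{sp}(F)-3$.
   Context: Graphs are finite and simple. For integers $q\ge3$ and $p\ge1$, the sparkler graph $S_{q,p}$ consists of a star $K_{1,q-1}$ with center $c$ and a path $v_1v_2\dots v_p$ together with the edge $cv_1$; its tail end vertex is $v_p$ (so $S_{q,1}\cong K_{1,q}$ with tail end vertex a leaf). For $p=0$, $S_{q,0}$ is the star $K_{1,q-1}$ and its tail end vertex is the center. For a vertex $v$ of a connected graph $F$, a $v$-branch of $F$ is the subgraph of $F$ induced by the vertex set of a connected component of $F- v$ together with $v$. A $v$-branch $S$ is a pendant sparkler subgraph $S_{q,p}$ of $F$ (with $q\ge3$, $p\ge0$) if $S$ is isomorphic to $S_{q,p}$ via an isomorphism sending $v$ to the tail end vertex, and $v$ has degree at least $3$ or exactly $1$ in $F$. If $F$ has a pendant sparkler subgraph, $\mathrm{sp}(F)$ denotes the maximum $p$ such that $F$ has a pendant sparkler subgraph $S_{q,p}$ for some $q\ge3$. First-order sentences are over the vocabulary $\{\sim,=\}$. A sentence $\Phi$ defines a class $\mathcal C$ asymptotically over connected graphs if there is $N$ such that for every connected graph $G$ with at least $N$ vertices, $G\models\Phi$ iff $G\in\mathcal C$. $W'(F)$ is the minimum number of distinct variables in a sentence defining, asymptotically over connected graphs, the class of graphs containing a (not necessarily induced) subgraph isomorphic to $F$. *)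

theory Defs
  imports "Graph_Theory.Graph_Theory"
begin

text \<open>
  Finite simple graphs are represented by \<^const>\<open>pair_graph\<close>, i.e. finite loopless symmetric digraphs
  without parallel arcs; an undirected edge is a pair of opposite arcs.
\<close>

subsection \<open>Pendant sparklers\<close>

datatype sparkler_vertex = Center | Leaf nat | Path nat

definition sparkler :: "nat \<Rightarrow> nat \<Rightarrow> sparkler_vertex pair_pre_digraph" where
  "sparkler q p =
    (let A = {(Center, Leaf i) | i. i \<in> {1..q - 1}}
           \<union> {(Center, Path i) | i. i = 1 \<and> i \<le> p}
           \<union> {(Path i, Path (i + 1)) | i. 1 \<le> i \<and> i + 1 \<le> p}
     in \<lparr> pverts = {Center} \<union> Leaf ` {1..q - 1} \<union> Path ` {1..p}, parcs = A \<union> A\<inverse> \<rparr>)"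

definition tail_end :: "nat \<Rightarrow> sparkler_vertex" where
  "tail_end p = (if p = 0 then Center else Path p)"

text \<open>On symmetric digraphs \<^const>\<open>pre_digraph.sccs_verts\<close> gives the vertex sets of the connected
  components.\<close>

definition branches :: "'a pair_pre_digraph \<Rightarrow> 'a \<Rightarrow> ('a, 'a \<times> 'a) pre_digraph set" where
  "branches F v =
    {F \<restriction> (insert v C) | C. C \<in> pre_digraph.sccs_verts (pre_digraph.del_vert (with_proj F) v)}"

text \<open>The out-degree of a vertex of a symmetric loopless digraph is its number of neighbours.\<close>

definition pendant_sparkler ::
    "'a pair_pre_digraph \<Rightarrow> 'a \<Rightarrow> ('a, 'a \<times> 'a) pre_digraph \<Rightarrow> nat \<Rightarrow> nat \<Rightarrow> bool" where
  "pendant_sparkler F v S q p \<longleftrightarrow>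
     3 \<le> q \<and> v \<in> pverts F \<and> S \<in> branches F v \<and>
     (\<exists>hom. pre_digraph.digraph_isomorphism S hom \<and> app_iso hom S = with_proj (sparkler q p) \<and>
            iso_verts hom v = tail_end p) \<and>
     (3 \<le> out_degree F v \<or> out_degree F v = 1)"

definition has_pendant_sparkler :: "'a pair_pre_digraph \<Rightarrow> bool" where
  "has_pendant_sparkler F \<longleftrightarrow> (\<exists>v S q p. pendant_sparkler F v S q p)"

definition sp :: "'a pair_pre_digraph \<Rightarrow> nat" where
  "sp F = Max {p. \<exists>v S q. pendant_sparkler F v S q p}"

subsection \<open>First-order logic of graphs\<close>

datatype fo =
    Eq nat nat
  | Adj nat nat
  | Neg fo
  | Conj fo fo
  | Disj fo fo
  | Exists nat fo
  | Forall nat fo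

primrec vars :: "fo \<Rightarrow> nat set" where
  "vars (Eq x y) = {x, y}"
| "vars (Adj x y) = {x, y}"
| "vars (Neg \<phi>) = vars \<phi>"
| "vars (Conj \<phi> \<psi>) = vars \<phi> \<union> vars \<psi>"
| "vars (Disj \<phi> \<psi>) = vars \<phi> \<union> vars \<psi>"
| "vars (Exists x \<phi>) = insert x (vars \<phi>)"
| "vars (Forall x \<phi>) = insert x (vars \<phi>)"

primrec free_vars :: "fo \<Rightarrow> nat set" where
  "free_vars (Eq x y) = {x, y}"
| "free_vars (Adj x y) = {x, y}"
| "free_vars (Neg \<phi>) = free_vars \<phi>"
| "free_vars (Conj \<phi> \<psi>) = free_vars \<phi> \<union> free_vars \<psi>"
| "free_vars (Disj \<phi> \<psi>) = free_vars \<phi> \<union> free_vars \<psi>"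
| "free_vars (Exists x \<phi>) = free_vars \<phi> - {x}"
| "free_vars (Forall x \<phi>) = free_vars \<phi> - {x}"

definition sentence :: "fo \<Rightarrow> bool" where
  "sentence \<phi> \<longleftrightarrow> free_vars \<phi> = {}"

primrec sat :: "'a pair_pre_digraph \<Rightarrow> (nat \<Rightarrow> 'a) \<Rightarrow> fo \<Rightarrow> bool" where
  "sat G s (Eq x y) \<longleftrightarrow> s x = s y"
| "sat G s (Adj x y) \<longleftrightarrow> (s x, s y) \<in> parcs G"
| "sat G s (Neg \<phi>) \<longleftrightarrow> \<not> sat G s \<phi>"
| "sat G s (Conj \<phi> \<psi>) \<longleftrightarrow> sat G s \<phi> \<and> sat G s \<psi>"
| "sat G s (Disj \<phi> \<psi>) \<longleftrightarrow> sat G s \<phi> \<or> sat G s \<psi>"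
| "sat G s (Exists x \<phi>) \<longleftrightarrow> (\<exists>a \<in> pverts G. sat G (s(x := a)) \<phi>)"
| "sat G s (Forall x \<phi>) \<longleftrightarrow> (\<forall>a \<in> pverts G. sat G (s(x := a)) \<phi>)"

definition models :: "'a pair_pre_digraph \<Rightarrow> fo \<Rightarrow> bool" where
  "models G \<phi> \<longleftrightarrow> (\<forall>s. range s \<subseteq> pverts G \<longrightarrow> sat G s \<phi>)"

text \<open>Every finite graph is isomorphic to one with vertices in \<^typ>\<open>nat\<close>, so classes of graphs are
  represented by their members over \<^typ>\<open>nat\<close>.\<close>

definition defines_asymptotically :: "fo \<Rightarrow> nat pair_pre_digraph set \<Rightarrow> bool" where
  "defines_asymptotically \<phi> \<C> \<longleftrightarrow>
    (\<exists>N. \<forall>G. pair_graph G \<and> Digraph_Component.connected G \<and> N \<le> card (pverts G) \<longrightarrow>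
      (models G \<phi> \<longleftrightarrow> G \<in> \<C>))"

definition graphs_containing :: "'a pair_pre_digraph \<Rightarrow> nat pair_pre_digraph set" where
  "graphs_containing F =
    {G. pair_graph G \<and> (\<exists>H. pair_graph H \<and> subgraph H G \<and> digraph_iso F H)}"

definition asymptotic_width :: "'a pair_pre_digraph \<Rightarrow> nat" where
  "asymptotic_width F =
    (LEAST k. \<exists>\<phi>. sentence \<phi> \<and> defines_asymptotically \<phi> (graphs_containing F) \<and> card (vars \<phi>) = k)"

end

theory Submission
  imports Defs
begin

text \<open>
  Take a sparkler with \<open>n\<close> leaves at its centre and tail \<open>0, \<dots>, p\<close>, and let the tail end \<open>p\<close> form a
  clique together with \<open>m\<close> further vertices. These \<open>m\<close> vertices are twins, and a sentence with \<open>k\<close>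
  variables cannot tell \<open>k\<close> twins from more of them. As a large clique contains \<open>F\<close>, a sentence
  defining containment of \<open>F\<close> forces a copy of \<open>F\<close> into every large such graph with \<open>m = k\<close>.

  For \<open>n = 0\<close> and a long tail this shows that all degrees of \<open>F\<close> are at most \<open>k + 1\<close>. Now let
  \<open>p = sp(F) + 1\<close>, let \<open>n\<close> be large, and suppose that \<open>F\<close> has more than \<open>k + sp(F) + 3\<close> vertices.
  Then its copy uses at least two leaves. If the copy avoids \<open>p\<close>, almost all of its vertices are
  leaves and the centre has degree above \<open>k + 1\<close>. Otherwise it uses the whole tail, and following
  that tail beyond \<open>p\<close> until the degree differs from 2 exhibits a pendant sparkler with a tail
  longer than \<open>sp(F)\<close>.
\<close>

section \<open>Embeddings and isomorphisms\<close>

lemma pair_graphI: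
  assumes "finite (pverts G)" and "parcs G \<subseteq> pverts G \<times> pverts G"
    and "sym (parcs G)" and "irrefl (parcs G)"
  shows "pair_graph G"
proof -
  have "finite (parcs G)"
    using assms(1,2) by (meson finite_SigmaI finite_subset)
  then show ?thesis
    using assms by unfold_locales (auto simp: symmetric_def irrefl_def)
qed

abbreviation neighbours :: "'a pair_pre_digraph \<Rightarrow> 'a \<Rightarrow> 'a set" where
  "neighbours G v \<equiv> parcs G `` {v}"

lemma out_degree_eq_card_neighbours: "out_degree (with_proj G) v = card (neighbours G v)"
proof -
  have "out_arcs (with_proj G) v = Pair v ` neighbours G v"
    by (auto simp: out_arcs_def)
  then show ?thesis
    by (simp add: out_degree_def card_image inj_on_def)
qed

lemma (in pair_wf_digraph) neighbours_subset_verts: "neighbours G v \<subseteq> pverts G"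
  by (auto dest: in_arcsD2)

lemma (in pair_fin_digraph) finite_neighbours: "finite (neighbours G v)"
  using neighbours_subset_verts pair_finite_verts by (rule finite_subset)

lemma (in pair_sym_digraph) arcs_symmetric_iff: "(u, v) \<in> parcs G \<longleftrightarrow> (v, u) \<in> parcs G"
  using arcs_symmetric by blast

definition embedding :: "('a \<Rightarrow> 'b) \<Rightarrow> 'a pair_pre_digraph \<Rightarrow> 'b pair_pre_digraph \<Rightarrow> bool" where
  "embedding f F G \<longleftrightarrow>
    inj_on f (pverts F) \<and> f ` pverts F \<subseteq> pverts G \<and> (\<forall>(u, v) \<in> parcs F. (f u, f v) \<in> parcs G)"

lemma embedding_arc: "embedding f F G \<Longrightarrow> (u, v) \<in> parcs F \<Longrightarrow> (f u, f v) \<in> parcs G"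
  by (auto simp: embedding_def)

lemma embedding_out_degree_le:
  assumes "pair_wf_digraph F" and "pair_fin_digraph G" and "embedding f F G"
  shows "out_degree (with_proj F) u \<le> out_degree (with_proj G) (f u)"
  unfolding out_degree_eq_card_neighbours
proof (rule card_inj_on_le)
  show "inj_on f (neighbours F u)"
    using assms(3) pair_wf_digraph.neighbours_subset_verts[OF assms(1)]
    unfolding embedding_def by (metis inj_on_subset)
  show "f ` neighbours F u \<subseteq> neighbours G (f u)"
    using embedding_arc[OF assms(3)] by auto
  show "finite (neighbours G (f u))"
    using assms(2) by (rule pair_fin_digraph.finite_neighbours)
qed

definition map_graph :: "('a \<Rightarrow> 'b) \<Rightarrow> 'a pair_pre_digraph \<Rightarrow> 'b pair_pre_digraph" where
  "map_graph f G = \<lparr> pverts = f ` pverts G, parcs = map_prod f f ` parcs G \<rparr>"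

definition vertex_iso ::
    "('a \<Rightarrow> 'b) \<Rightarrow> ('a, 'a \<times> 'a, 'b, 'b \<times> 'b) digraph_isomorphism" where
  "vertex_iso f =
    \<lparr> iso_verts = f, iso_arcs = map_prod f f, iso_head = snd, iso_tail = fst \<rparr>"

lemma iso_verts_vertex_iso: "iso_verts (vertex_iso f) = f"
  by (simp add: vertex_iso_def)

lemma app_iso_vertex_iso: "app_iso (vertex_iso f) (with_proj G) = with_proj (map_graph f G)"
  by (simp add: app_iso_def vertex_iso_def map_graph_def with_proj_def)

lemma (in pair_wf_digraph) digraph_isomorphism_vertex_iso:
  assumes "inj_on f (pverts G)"
  shows "digraph_isomorphism (vertex_iso f)"
proof -
  have "parcs G \<subseteq> pverts G \<times> pverts G"
    by (auto dest: wellformed')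
  then have "inj_on (map_prod f f) (parcs G)"
    by (rule inj_on_subset[OF map_prod_inj_on[OF assms assms]])
  then show ?thesis
    using assms wf_digraph_axioms by (auto simp: digraph_isomorphism_def vertex_iso_def)
qed

lemma (in pair_graph) pair_graph_map_graph:
  assumes "inj_on f (pverts G)"
  shows "pair_graph (map_graph f G)"
proof (rule pair_graphI)
  show "finite (pverts (map_graph f G))"
    using pair_finite_verts by (simp add: map_graph_def)
  show "parcs (map_graph f G) \<subseteq> pverts (map_graph f G) \<times> pverts (map_graph f G)"
    by (auto simp: map_graph_def dest: wellformed')
  show "sym (parcs (map_graph f G))"
    by (auto simp: map_graph_def sym_def) (metis arcs_symmetric map_prod_imageI)
  show "irrefl (parcs (map_graph f G))"
    using inj_onD[OF assms] no_loops'
    by (fastforce simp: map_graph_def irrefl_def dest: wellformed')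
qed

lemma (in pair_wf_digraph) digraph_iso_iff_map_graph:
  "digraph_iso (with_proj G) (with_proj H) \<longleftrightarrow> (\<exists>f. inj_on f (pverts G) \<and> H = map_graph f G)"
proof
  assume "digraph_iso (with_proj G) (with_proj H)"
  then obtain h where h: "digraph_isomorphism h" and H: "with_proj H = app_iso h (with_proj G)"
    unfolding digraph_iso_def by blast
  have ends: "iso_tail h = fst" "iso_head h = snd"
    using arg_cong[OF H, of tail] arg_cong[OF H, of head] by simp_all
  have "iso_arcs h a = map_prod (iso_verts h) (iso_verts h) a" if "a \<in> parcs G" for a
    using h that ends by (cases a) (auto simp: digraph_isomorphism_def prod_eq_iff)
  moreover have "pverts H = iso_verts h ` pverts G" "parcs H = iso_arcs h ` parcs G"
    using arg_cong[OF H, of verts] arg_cong[OF H, of arcs] by simp_all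
  ultimately have "H = map_graph (iso_verts h) G"
    by (simp add: map_graph_def cong: image_cong)
  then show "\<exists>f. inj_on f (pverts G) \<and> H = map_graph f G"
    using digraph_isomorphism_inj_on_verts[OF h] by blast
next
  assume "\<exists>f. inj_on f (pverts G) \<and> H = map_graph f G"
  then obtain f where "inj_on f (pverts G)" "H = map_graph f G"
    by blast
  then show "digraph_iso (with_proj G) (with_proj H)"
    unfolding digraph_iso_def
    using digraph_isomorphism_vertex_iso app_iso_vertex_iso by metis
qed

lemma graphs_containing_iff_embedding:
  assumes "pair_graph F" and "pair_graph G"
  shows "G \<in> graphs_containing F \<longleftrightarrow> (\<exists>f. embedding f F G)"
proof -
  interpret F: pair_graph F by fact
  interpret G: pair_graph G by fact
  have subgraph_iff: "subgraph (with_proj (map_graph f F)) (with_proj G) \<longleftrightarrow> embedding f F G"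
    if "inj_on f (pverts F)" for f
  proof -
    interpret H: pair_graph "map_graph f F"
      using that by (rule F.pair_graph_map_graph)
    show ?thesis
      using that H.wf_digraph G.wf_digraph
      by (auto simp: subgraph_def compatible_def embedding_def map_graph_def)
  qed
  have "G \<in> graphs_containing F \<longleftrightarrow>
      (\<exists>f. inj_on f (pverts F) \<and> subgraph (with_proj (map_graph f F)) (with_proj G))"
    unfolding graphs_containing_def F.digraph_iso_iff_map_graph
    using F.pair_graph_map_graph assms(2) by auto
  also have "\<dots> \<longleftrightarrow> (\<exists>f. embedding f F G)"
    using subgraph_iff by (metis embedding_def)
  finally show ?thesis .
qed

section \<open>Connectedness\<close>

lemma (in wf_digraph) reachable_crossing_arc:
  assumes "a \<rightarrow>\<^sup>* b" and "a \<in> A" and "b \<notin> A"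
  obtains x y where "x \<rightarrow> y" and "x \<in> A" and "y \<notin> A"
proof -
  have "b \<in> A" if "\<And>x y. x \<rightarrow> y \<Longrightarrow> x \<in> A \<Longrightarrow> y \<in> A"
    using assms(1) by (induction rule: reachable_induct) (use assms(2) that in blast)+
  then show thesis
    using assms(3) that by blast
qed

lemma (in wf_digraph) in_sccs_vertsI_closed:
  assumes "symmetric G" and "r \<in> C" and "r \<in> verts G"
    and reach: "\<And>u. u \<in> C \<Longrightarrow> u \<rightarrow>\<^sup>* r"
    and closed: "\<And>u v. u \<in> C \<Longrightarrow> u \<rightarrow> v \<Longrightarrow> v \<in> C"
  shows "C \<in> sccs_verts"
proof -
  have "u \<in> C" if "r \<rightarrow>\<^sup>* u" for u
    using reachable_crossing_arc[OF that \<open>r \<in> C\<close>] closed by blast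
  then have "C = scc_of r"
    using reach symmetric_reachable[OF assms(1)] unfolding scc_of_def by blast
  then show ?thesis
    using scc_of_in_sccs_verts[OF assms(3)] by simp
qed

lemma (in sym_digraph) connectedI_reachable:
  assumes "r \<in> verts G" and "\<And>u. u \<in> verts G \<Longrightarrow> u \<rightarrow>\<^sup>* r"
  shows "connected G"
proof (rule connectedI)
  show "verts G \<noteq> {}"
    using assms(1) by auto
  fix u v assume "u \<in> verts G" "v \<in> verts G"
  then have "u \<rightarrow>\<^sup>* v"
    using assms(2) symmetric_reachable' reachable_trans by metis
  then show "u \<rightarrow>\<^sup>*\<^bsub>mk_symmetric G\<^esub> v"
    by (rule reachable_mk_symmetricI)
qed

lemma (in sym_digraph) connected_crossing_arc:
  assumes "connected G" and "a \<in> A" and "a \<in> verts G" and "b \<in> verts G" and "b \<notin> A"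
  obtains x y where "x \<rightarrow> y" and "x \<in> A" and "y \<notin> A"
proof -
  have "a \<rightarrow>\<^sup>* b"
    using symmetric_connected_imp_strongly_connected[OF sym_arcs assms(1)] assms(3,4)
    by (auto simp: strongly_connected_def)
  then show thesis
    using assms(2,5) that by (rule reachable_crossing_arc)
qed

section \<open>First-order logic with few variables\<close>

lemma finite_vars: "finite (vars \<phi>)"
  by (induction \<phi>) auto

lemma vars_nonempty: "vars \<phi> \<noteq> {}"
  by (induction \<phi>) auto

lemma card_vars_pos: "1 \<le> card (vars \<phi>)"
  using finite_vars vars_nonempty by (simp add: Suc_le_eq card_gt_0_iff)

lemma sat_cong:
  assumes "\<And>x. x \<in> free_vars \<phi> \<Longrightarrow> s x = s' x"
  shows "sat G s \<phi> \<longleftrightarrow> sat G s' \<phi>"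
  using assms
proof (induction \<phi> arbitrary: s s')
  case (Exists x \<phi>)
  have "sat G (s(x := a)) \<phi> \<longleftrightarrow> sat G (s'(x := a)) \<phi>" for a
    using Exists.prems by (intro Exists.IH) simp
  then show ?case by simp
next
  case (Forall x \<phi>)
  have "sat G (s(x := a)) \<phi> \<longleftrightarrow> sat G (s'(x := a)) \<phi>" for a
    using Forall.prems by (intro Forall.IH) simp
  then show ?case by simp
next
  case (Neg \<phi>)
  show ?case
    using Neg.IH[OF Neg.prems] by simp
next
  case (Conj \<phi> \<psi>)
  show ?case
    using Conj.IH(1)[OF Conj.prems] Conj.IH(2)[OF Conj.prems] by simp
next
  case (Disj \<phi> \<psi>)
  show ?case
    using Disj.IH(1)[OF Disj.prems] Disj.IH(2)[OF Disj.prems] by simp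
qed simp_all

lemma models_iff_sat:
  assumes "sentence \<phi>" and "range s \<subseteq> pverts G"
  shows "models G \<phi> \<longleftrightarrow> sat G s \<phi>"
proof -
  have "sat G s' \<phi> \<longleftrightarrow> sat G s \<phi>" for s'
    by (rule sat_cong) (use assms(1) in \<open>simp add: sentence_def\<close>)
  then show ?thesis
    using assms(2) unfolding models_def by blast
qed

text \<open>A winning strategy of Duplicator in the game on \<open>G\<close> and \<open>H\<close> with pebbles named by \<open>X\<close>, given
  by the set \<open>Z\<close> of positions in which she stays.\<close>

definition back_and_forth ::
    "nat set \<Rightarrow> 'a pair_pre_digraph \<Rightarrow> 'b pair_pre_digraph \<Rightarrow>
      ((nat \<Rightarrow> 'a) \<Rightarrow> (nat \<Rightarrow> 'b) \<Rightarrow> bool) \<Rightarrow> bool" where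
  "back_and_forth X G H Z \<longleftrightarrow>
    (\<forall>s s'. Z s s' \<longrightarrow>
      (\<forall>x \<in> X. \<forall>y \<in> X. (s x = s y \<longleftrightarrow> s' x = s' y) \<and>
        ((s x, s y) \<in> parcs G \<longleftrightarrow> (s' x, s' y) \<in> parcs H)) \<and>
      (\<forall>x \<in> X. \<forall>a \<in> pverts G. \<exists>a' \<in> pverts H. Z (s(x := a)) (s'(x := a'))) \<and>
      (\<forall>x \<in> X. \<forall>a' \<in> pverts H. \<exists>a \<in> pverts G. Z (s(x := a)) (s'(x := a'))))"

lemma back_and_forth_Bex_iff:
  assumes "back_and_forth X G H Z" and "Z s s'" and "x \<in> X"
    and iff: "\<And>t t'. Z t t' \<Longrightarrow> P t \<longleftrightarrow> Q t'"
  shows "(\<exists>a \<in> pverts G. P (s(x := a))) \<longleftrightarrow> (\<exists>a' \<in> pverts H. Q (s'(x := a')))"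
proof -
  have forward: "\<exists>a' \<in> pverts H. Z (s(x := a)) (s'(x := a'))" if "a \<in> pverts G" for a
    using assms(1-3) that by (simp add: back_and_forth_def)
  have backward: "\<exists>a \<in> pverts G. Z (s(x := a)) (s'(x := a'))" if "a' \<in> pverts H" for a'
    using assms(1-3) that by (simp add: back_and_forth_def)
  show ?thesis
    using forward backward iff by meson
qed

lemma back_and_forth_sat_iff:
  assumes "back_and_forth X G H Z" and "vars \<phi> \<subseteq> X" and "Z s s'"
  shows "sat G s \<phi> \<longleftrightarrow> sat H s' \<phi>"
  using assms(2,3)
proof (induction \<phi> arbitrary: s s')
  case (Eq x y)
  then show ?case
    using assms(1) by (simp add: back_and_forth_def)
next
  case (Adj x y)
  then show ?case
    using assms(1) by (simp add: back_and_forth_def)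
next
  case (Exists x \<phi>)
  have "(\<exists>a \<in> pverts G. sat G (s(x := a)) \<phi>) \<longleftrightarrow> (\<exists>a' \<in> pverts H. sat H (s'(x := a')) \<phi>)"
    by (rule back_and_forth_Bex_iff[OF assms(1), where P = "\<lambda>t. sat G t \<phi>"])
      (use Exists in simp_all)
  then show ?case by simp
next
  case (Forall x \<phi>)
  have "(\<exists>a \<in> pverts G. \<not> sat G (s(x := a)) \<phi>) \<longleftrightarrow> (\<exists>a' \<in> pverts H. \<not> sat H (s'(x := a')) \<phi>)"
    by (rule back_and_forth_Bex_iff[OF assms(1), where P = "\<lambda>t. \<not> sat G t \<phi>"])
      (use Forall in simp_all)
  then show ?case by auto
qed simp_all

lemma back_and_forth_models_iff:
  assumes "back_and_forth (vars \<phi>) G H Z" and "sentence \<phi>" and "Z s s'"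
    and "range s \<subseteq> pverts G" and "range s' \<subseteq> pverts H"
  shows "models G \<phi> \<longleftrightarrow> models H \<phi>"
proof -
  have "models G \<phi> \<longleftrightarrow> sat G s \<phi>"
    using assms(2,4) by (rule models_iff_sat)
  also have "\<dots> \<longleftrightarrow> sat H s' \<phi>"
    using assms(1) subset_refl assms(3) by (rule back_and_forth_sat_iff)
  also have "\<dots> \<longleftrightarrow> models H \<phi>"
    using models_iff_sat[OF assms(2,5)] by simp
  finally show ?thesis .
qed

section \<open>Sentences defining subgraph containment\<close>

lemma free_vars_foldr_Exists: "free_vars (foldr Exists xs \<phi>) = free_vars \<phi> - set xs"
  by (induction xs) auto

lemma sat_foldr_Exists:
  "sat G s (foldr Exists xs \<phi>) \<longleftrightarrow>
    (\<exists>s'. (\<forall>x. x \<notin> set xs \<longrightarrow> s' x = s x) \<and> s' ` set xs \<subseteq> pverts G \<and> sat G s' \<phi>)"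
proof (induction xs arbitrary: s)
  case Nil
  have "s' = s" if "\<forall>x. s' x = s x" for s'
    using that by auto
  then show ?case by auto
next
  case (Cons x xs)
  have "sat G s (foldr Exists (x # xs) \<phi>) \<longleftrightarrow>
      (\<exists>a s'. a \<in> pverts G \<and> (\<forall>y. y \<notin> set xs \<longrightarrow> s' y = (s(x := a)) y) \<and>
        s' ` set xs \<subseteq> pverts G \<and> sat G s' \<phi>)"
    using Cons.IH by auto
  also have "\<dots> \<longleftrightarrow>
      (\<exists>s'. (\<forall>y. y \<notin> set (x # xs) \<longrightarrow> s' y = s y) \<and> s' ` set (x # xs) \<subseteq> pverts G \<and> sat G s' \<phi>)"
    (is "?lhs \<longleftrightarrow> ?rhs")
  proof
    assume ?lhs
    then obtain a s' where s': "a \<in> pverts G" "\<forall>y. y \<notin> set xs \<longrightarrow> s' y = (s(x := a)) y"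
      "s' ` set xs \<subseteq> pverts G" "sat G s' \<phi>"
      by blast
    then have "s' x \<in> pverts G"
      by (cases "x \<in> set xs") auto
    with s' show ?rhs
      by (intro exI[of _ s']) auto
  next
    assume ?rhs
    then obtain s' where s': "\<forall>y. y \<notin> set (x # xs) \<longrightarrow> s' y = s y"
      "s' ` set (x # xs) \<subseteq> pverts G" "sat G s' \<phi>"
      by blast
    then show ?lhs
      by (intro exI[of _ "s' x"] exI[of _ s']) auto
  qed
  finally show ?case .
qed

definition Conjs :: "fo list \<Rightarrow> fo" where
  "Conjs \<phi>s = foldr Conj \<phi>s (Forall 0 (Eq 0 0))"

lemma sat_Conjs: "sat G s (Conjs \<phi>s) \<longleftrightarrow> (\<forall>\<phi> \<in> set \<phi>s. sat G s \<phi>)"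
  unfolding Conjs_def by (induction \<phi>s) auto

lemma free_vars_Conjs: "free_vars (Conjs \<phi>s) = \<Union>(free_vars ` set \<phi>s)"
  unfolding Conjs_def by (induction \<phi>s) auto

text \<open>The vertex \<open>v\<close> of \<open>F\<close> is represented by the variable \<open>e v\<close>.\<close>

lemma formula_embeddingE:
  assumes "pair_fin_digraph F"
  obtains \<psi> where "free_vars \<psi> \<subseteq> e ` pverts F"
    and "\<forall>(G :: 'b pair_pre_digraph) s. s ` e ` pverts F \<subseteq> pverts G \<longrightarrow>
      (sat G s \<psi> \<longleftrightarrow> embedding (s \<circ> e) F G)"
proof -
  interpret F: pair_fin_digraph F by fact
  obtain arcs where arcs: "set arcs = parcs F"
    using finite_list[OF F.pair_finite_arcs] by blast
  have "finite (pverts F \<times> pverts F - Id)"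
    using F.pair_finite_verts by simp
  then obtain pairs where pairs: "set pairs = pverts F \<times> pverts F - Id"
    using finite_list by blast
  define \<psi> where "\<psi> = Conjs (map (\<lambda>(u, v). Adj (e u) (e v)) arcs @
    map (\<lambda>(u, v). Neg (Eq (e u) (e v))) pairs)"
  have "free_vars \<psi> \<subseteq> e ` pverts F"
    using F.wellformed' by (fastforce simp: \<psi>_def free_vars_Conjs arcs pairs)
  moreover have "sat G s \<psi> \<longleftrightarrow> embedding (s \<circ> e) F G" if "s ` e ` pverts F \<subseteq> pverts G"
    for G :: "'b pair_pre_digraph" and s
  proof -
    have "sat G s \<psi> \<longleftrightarrow> (\<forall>(u, v) \<in> parcs F. (s (e u), s (e v)) \<in> parcs G) \<and>
        (\<forall>(u, v) \<in> pverts F \<times> pverts F - Id. s (e u) \<noteq> s (e v))"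
      by (simp add: \<psi>_def sat_Conjs ball_Un arcs pairs split_def)
    also have "\<dots> \<longleftrightarrow> embedding (s \<circ> e) F G"
      using that by (auto simp: embedding_def inj_on_def)
    finally show ?thesis .
  qed
  ultimately show thesis
    using that by blast
qed

lemma assignment_extendingE:
  assumes "inj_on e A"
  obtains s' where "\<And>v. v \<in> A \<Longrightarrow> s' (e v) = f v" and "\<And>x. x \<notin> e ` A \<Longrightarrow> s' x = s x"
proof
  let ?s' = "\<lambda>x. if x \<in> e ` A then f (the_inv_into A e x) else s x"
  show "?s' (e v) = f v" if "v \<in> A" for v
    using that by (simp add: the_inv_into_f_f[OF assms])
qed simp

lemma ex_sentence_embedding:
  assumes "pair_fin_digraph F"
  shows "\<exists>\<phi>. sentence \<phi> \<and> (\<forall>(G :: 'b pair_pre_digraph) s. sat G s \<phi> \<longleftrightarrow> (\<exists>f. embedding f F G))"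
proof -
  interpret F: pair_fin_digraph F by fact
  obtain e :: "'a \<Rightarrow> nat" where e: "inj_on e (pverts F)"
    using finite_imp_inj_to_nat_seg[OF F.pair_finite_verts] by blast
  obtain xs where xs: "set xs = e ` pverts F"
    using finite_list[of "e ` pverts F"] F.pair_finite_verts by blast
  obtain \<psi> where free: "free_vars \<psi> \<subseteq> e ` pverts F"
    and "\<forall>(G :: 'b pair_pre_digraph) s. s ` e ` pverts F \<subseteq> pverts G \<longrightarrow>
      (sat G s \<psi> \<longleftrightarrow> embedding (s \<circ> e) F G)"
    by (rule formula_embeddingE[OF assms])
  note sat = this(2)[rule_format]
  have "sat G s (foldr Exists xs \<psi>) \<longleftrightarrow> (\<exists>f. embedding f F G)"
    for G :: "'b pair_pre_digraph" and s
  proof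
    assume "sat G s (foldr Exists xs \<psi>)"
    then obtain s' where "s' ` e ` pverts F \<subseteq> pverts G" "sat G s' \<psi>"
      unfolding sat_foldr_Exists xs by blast
    then have "embedding (s' \<circ> e) F G"
      using sat by simp
    then show "\<exists>f. embedding f F G" by blast
  next
    assume "\<exists>f. embedding f F G"
    then obtain f where f: "embedding f F G" ..
    obtain s' where s'_e: "\<And>v. v \<in> pverts F \<Longrightarrow> s' (e v) = f v"
      and outside: "\<And>x. x \<notin> e ` pverts F \<Longrightarrow> s' x = s x"
      using assignment_extendingE[OF e] by metis
    have range: "s' ` e ` pverts F \<subseteq> pverts G"
      using f s'_e by (auto simp: embedding_def)
    have "embedding (s' \<circ> e) F G"
      using f s'_e F.wellformed' by (fastforce simp: embedding_def inj_on_def)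
    then have "sat G s' \<psi>"
      using sat[OF range] by simp
    then show "sat G s (foldr Exists xs \<psi>)"
      unfolding sat_foldr_Exists xs using range outside by blast
  qed
  moreover have "sentence (foldr Exists xs \<psi>)"
    using free by (simp add: sentence_def free_vars_foldr_Exists xs)
  ultimately show ?thesis by blast
qed

lemma ex_sentence_defining_graphs_containing:
  assumes "pair_graph F"
  shows "\<exists>\<phi>. sentence \<phi> \<and> defines_asymptotically \<phi> (graphs_containing F)"
proof -
  interpret F: pair_graph F by fact
  obtain \<phi> where \<phi>: "sentence \<phi>"
    and sat: "\<And>(G :: nat pair_pre_digraph) s. sat G s \<phi> \<longleftrightarrow> (\<exists>f. embedding f F G)"
    using ex_sentence_embedding[OF F.pair_fin_digraph] by blast
  have "models G \<phi> \<longleftrightarrow> G \<in> graphs_containing F"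
    if "pair_graph G" and conn: "Digraph_Component.connected (with_proj G)"
    for G :: "nat pair_pre_digraph"
  proof -
    obtain a where "a \<in> pverts G"
      using conn by (fastforce simp: Digraph_Component.connected_def strongly_connected_def)
    then have "models G \<phi> \<longleftrightarrow> sat G (\<lambda>_. a) \<phi>"
      by (intro models_iff_sat[OF \<phi>]) auto
    then show ?thesis
      using sat graphs_containing_iff_embedding[OF assms \<open>pair_graph G\<close>] by simp
  qed
  then show ?thesis
    using \<phi> unfolding defines_asymptotically_def by blast
qed

section \<open>Twins cannot be counted with few variables\<close>

definition closed_twins :: "'a pair_pre_digraph \<Rightarrow> 'a set \<Rightarrow> bool" where
  "closed_twins G T \<longleftrightarrow> T \<subseteq> pverts G \<and>
    (\<forall>x \<in> T. \<forall>y \<in> T. insert x (neighbours G x) = insert y (neighbours G y))"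

lemma closed_twins_eq:
  "closed_twins G T \<Longrightarrow> u \<in> T \<Longrightarrow> v \<in> T \<Longrightarrow> insert u (neighbours G u) = insert v (neighbours G v)"
  unfolding closed_twins_def by blast

lemma (in pair_graph) closed_twins_adjacent_iff:
  assumes "closed_twins G T" and "u \<in> T" and "v \<in> T"
  shows "(u, v) \<in> parcs G \<longleftrightarrow> u \<noteq> v"
  using closed_twins_eq[OF assms] no_loops' by blast

lemma closed_twins_common_neighbour:
  assumes "closed_twins G T" and "u \<in> T" and "v \<in> T" and "r \<notin> T"
  shows "(u, r) \<in> parcs G \<longleftrightarrow> (v, r) \<in> parcs G"
proof -
  have "r \<noteq> u" "r \<noteq> v"
    using assms(2-4) by auto
  then show ?thesis
    using closed_twins_eq[OF assms(1-3)] by (metis Image_singleton_iff insert_iff)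
qed

text \<open>A position of the game on two graphs with a common part \<open>R\<close> and sets \<open>T\<close>, \<open>T'\<close> of twins.\<close>

definition twin_position ::
    "nat set \<Rightarrow> 'a set \<Rightarrow> 'a set \<Rightarrow> 'a set \<Rightarrow> (nat \<Rightarrow> 'a) \<Rightarrow> (nat \<Rightarrow> 'a) \<Rightarrow> bool" where
  "twin_position X R T T' s s' \<longleftrightarrow>
    (\<forall>x \<in> X. s x \<in> R \<and> s' x = s x \<or> s x \<in> T \<and> s' x \<in> T') \<and>
    (\<forall>x \<in> X. \<forall>y \<in> X. s x = s y \<longleftrightarrow> s' x = s' y)"

lemma twin_position_commute: "twin_position X R T T' s s' \<longleftrightarrow> twin_position X R T' T s' s"
  unfolding twin_position_def by auto

lemma twin_position_upd:
  assumes "twin_position X R T T' s s'" and "a \<in> R \<and> a' = a \<or> a \<in> T \<and> a' \<in> T'"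
    and "\<And>y. y \<in> X - {x} \<Longrightarrow> s y = a \<longleftrightarrow> s' y = a'"
  shows "twin_position X R T T' (s(x := a)) (s'(x := a'))"
  unfolding twin_position_def
proof (intro conjI ballI)
  fix y assume "y \<in> X"
  then show "(s(x := a)) y \<in> R \<and> (s'(x := a')) y = (s(x := a)) y \<or>
      (s(x := a)) y \<in> T \<and> (s'(x := a')) y \<in> T'"
    using assms(1,2) by (simp add: twin_position_def)
  fix z assume "z \<in> X"
  then show "(s(x := a)) y = (s(x := a)) z \<longleftrightarrow> (s'(x := a')) y = (s'(x := a')) z"
    using \<open>y \<in> X\<close> assms(1) assms(3)[of y] assms(3)[of z] by (auto simp: twin_position_def)
qed

lemma ex_fresh_value:
  assumes "finite X" and "x \<in> X" and "card X \<le> card T"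
  shows "\<exists>a \<in> T. a \<notin> s ` (X - {x})"
proof -
  have "card (s ` (X - {x})) \<le> card (X - {x})"
    using assms(1) by (intro card_image_le) simp
  also have "\<dots> < card X"
    using assms(1,2) by (rule card_Diff1_less)
  also have "\<dots> \<le> card T" by fact
  finally have "\<not> T \<subseteq> s ` (X - {x})"
    using assms(1) by (meson card_mono finite_Diff finite_imageI linorder_not_less)
  then show ?thesis by blast
qed

lemma twin_position_extend:
  assumes pos: "twin_position X R T T' s s'"
    and X: "finite X" "x \<in> X" "card X \<le> card T'"
    and disj: "R \<inter> T = {}" "R \<inter> T' = {}"
    and a: "a \<in> R \<union> T"
  shows "\<exists>a' \<in> R \<union> T'. twin_position X R T T' (s(x := a)) (s'(x := a'))"
proof -
  have place: "s y \<in> R \<and> s' y = s y \<or> s y \<in> T \<and> s' y \<in> T'" if "y \<in> X" for y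
    using pos that by (simp add: twin_position_def)
  have same: "s y = s z \<longleftrightarrow> s' y = s' z" if "y \<in> X" "z \<in> X" for y z
    using pos that by (simp add: twin_position_def)
  consider (common) "a \<in> R" | (old) y where "a \<in> T" "y \<in> X" "s y = a"
    | (new) "a \<in> T" "\<forall>y \<in> X. s y \<noteq> a"
    using a by blast
  then show ?thesis
  proof cases
    case common
    then have "s y = a \<longleftrightarrow> s' y = a" if "y \<in> X" for y
      using place[OF that] disj by auto
    then have "twin_position X R T T' (s(x := a)) (s'(x := a))"
      using twin_position_upd[OF pos] common by blast
    with common show ?thesis by blast
  next
    case old
    then have "s' y \<in> T'"
      using place[of y] disj(1) by blast
    moreover from this have "twin_position X R T T' (s(x := a)) (s'(x := s' y))"
      using old same by (intro twin_position_upd[OF pos]) auto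
    ultimately show ?thesis by blast
  next
    case new
    obtain a' where "a' \<in> T'" "a' \<notin> s' ` (X - {x})"
      using ex_fresh_value[OF X] by blast
    moreover from this have "twin_position X R T T' (s(x := a)) (s'(x := a'))"
      using new by (intro twin_position_upd[OF pos]) auto
    ultimately show ?thesis by blast
  qed
qed

lemma twin_position_arc_iff:
  assumes "pair_graph G" and "closed_twins G T" and "T' \<subseteq> T" and "R \<inter> T = {}"
    and pos: "twin_position X R T T' s s'" and "x \<in> X" and "y \<in> X"
  shows "(s x, s y) \<in> parcs G \<longleftrightarrow> (s' x, s' y) \<in> parcs G"
proof -
  interpret G: pair_graph G by fact
  have same: "s x = s y \<longleftrightarrow> s' x = s' y"
    and "s x \<in> R \<and> s' x = s x \<or> s x \<in> T \<and> s' x \<in> T'"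
    and "s y \<in> R \<and> s' y = s y \<or> s y \<in> T \<and> s' y \<in> T'"
    using pos assms(6,7) by (simp_all add: twin_position_def)
  then consider (common) "s' x = s x" "s' y = s y"
    | (left) "s x \<in> T" "s' x \<in> T" "s y \<in> R" "s' y = s y"
    | (right) "s x \<in> R" "s' x = s x" "s y \<in> T" "s' y \<in> T"
    | (twins) "s x \<in> T" "s' x \<in> T" "s y \<in> T" "s' y \<in> T"
    using assms(3) by blast
  then show ?thesis
  proof cases
    case common
    then show ?thesis by simp
  next
    case left
    then show ?thesis
      using closed_twins_common_neighbour[OF assms(2), of "s x" "s' x" "s y"] assms(4) by auto
  next
    case right
    then show ?thesis
      using closed_twins_common_neighbour[OF assms(2), of "s y" "s' y" "s x"] assms(4)
      by (auto simp: G.arcs_symmetric_iff[of "s x"])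
  next
    case twins
    then show ?thesis using G.closed_twins_adjacent_iff[OF assms(2)] same by simp
  qed
qed

lemma verts_common_part_twins:
  assumes "closed_twins G T" and "induced_subgraph (with_proj H) (with_proj G)"
    and "pverts G - pverts H \<subseteq> T"
  shows "pverts G = (pverts G - T) \<union> T" and "pverts H = (pverts G - T) \<union> (T \<inter> pverts H)"
proof -
  have "T \<subseteq> pverts G"
    using assms(1) by (simp add: closed_twins_def)
  moreover have "pverts H \<subseteq> pverts G"
    using assms(2) by (auto elim!: induced_subgraphE subgraphE)
  ultimately show "pverts G = (pverts G - T) \<union> T" "pverts H = (pverts G - T) \<union> (T \<inter> pverts H)"
    using assms(3) by blast+
qed

lemma back_and_forth_twin_position:
  assumes "pair_graph G" and "closed_twins G T"
    and H: "induced_subgraph (with_proj H) (with_proj G)" "pverts G - pverts H \<subseteq> T"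
    and X: "finite X" "card X \<le> card (T \<inter> pverts H)"
  shows "back_and_forth X G H (twin_position X (pverts G - T) T (T \<inter> pverts H))"
proof -
  interpret G: pair_graph G by fact
  let ?R = "pverts G - T" and ?T' = "T \<inter> pverts H"
  let ?Z = "twin_position X ?R T ?T'"
  note verts = verts_common_part_twins[OF assms(2) H]
  have "finite T"
    using verts(1) G.pair_finite_verts by (metis finite_Un)
  then have card_T: "card X \<le> card T"
    using X(2) card_mono[of T ?T'] by simp
  have parcs_H: "(u, v) \<in> parcs H \<longleftrightarrow> (u, v) \<in> parcs G" if "u \<in> pverts H" "v \<in> pverts H" for u v
    using H(1) that by (auto elim!: induced_subgraphE)
  show ?thesis
    unfolding back_and_forth_def
  proof (intro allI impI conjI ballI)
    fix s s' x y assume pos: "?Z s s'" and xy: "x \<in> X" "y \<in> X"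
    then show "s x = s y \<longleftrightarrow> s' x = s' y"
      by (simp add: twin_position_def)
    have "s' z \<in> pverts H" if "z \<in> X" for z
      using pos that H(2) by (fastforce simp: twin_position_def)
    then show "(s x, s y) \<in> parcs G \<longleftrightarrow> (s' x, s' y) \<in> parcs H"
      using twin_position_arc_iff[OF assms(1,2) Int_lower1 _ pos xy] parcs_H xy by auto
  next
    fix s s' x a assume "?Z s s'" "x \<in> X" "a \<in> pverts G"
    then have "\<exists>a' \<in> ?R \<union> ?T'. ?Z (s(x := a)) (s'(x := a'))"
      using X verts(1) by (intro twin_position_extend) auto
    then show "\<exists>a' \<in> pverts H. ?Z (s(x := a)) (s'(x := a'))"
      using verts(2) by simp
  next
    fix s s' x a' assume "?Z s s'" "x \<in> X" "a' \<in> pverts H"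
    then have "\<exists>a \<in> ?R \<union> T. twin_position X ?R ?T' T (s'(x := a')) (s(x := a))"
      using X(1) card_T verts(2) by (intro twin_position_extend) (auto simp: twin_position_commute)
    then show "\<exists>a \<in> pverts G. ?Z (s(x := a)) (s'(x := a'))"
      using verts(1) by (simp add: twin_position_commute[of X ?R T])
  qed
qed

lemma closed_twins_models_iff:
  assumes "pair_graph G" and "closed_twins G T"
    and "induced_subgraph (with_proj H) (with_proj G)" and "pverts G - pverts H \<subseteq> T"
    and "sentence \<phi>" and "card (vars \<phi>) \<le> card (T \<inter> pverts H)"
  shows "models G \<phi> \<longleftrightarrow> models H \<phi>"
proof -
  have "T \<inter> pverts H \<noteq> {}"
    using assms(6) card_vars_pos[of \<phi>] by force
  then obtain a where a: "a \<in> T" "a \<in> pverts H" by blast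
  then have "a \<in> pverts G"
    using assms(2) by (auto simp: closed_twins_def)
  then show ?thesis
    using a back_and_forth_models_iff[OF
        back_and_forth_twin_position[OF assms(1-4) finite_vars assms(6)] assms(5),
        of "\<lambda>_. a" "\<lambda>_. a"]
    by (simp add: twin_position_def image_subset_iff)
qed

section \<open>Sparklers with a clique at the tail end\<close>

text \<open>The path is \<open>{..p}\<close>, the leaves at \<open>0\<close> are \<open>{p<..p + n}\<close>, and the remaining \<open>m\<close> vertices
  form a clique together with \<open>p\<close>.\<close>

definition sparkler_clique :: "nat \<Rightarrow> nat \<Rightarrow> nat \<Rightarrow> nat pair_pre_digraph" where
  "sparkler_clique p n m =
    (let K = insert p {p + n<..p + n + m};
         A = {(i, Suc i) | i. i < p} \<union> {0} \<times> {p<..p + n}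
     in \<lparr> pverts = {..p + n + m}, parcs = A \<union> A\<inverse> \<union> (K \<times> K - Id) \<rparr>)"

lemma pverts_sparkler_clique: "pverts (sparkler_clique p n m) = {..p + n + m}"
  by (simp add: sparkler_clique_def Let_def)

lemma parcs_sparkler_clique_iff:
  "(x, y) \<in> parcs (sparkler_clique p n m) \<longleftrightarrow>
    y = Suc x \<and> x < p \<or> x = Suc y \<and> y < p \<or>
    x = 0 \<and> y \<in> {p<..p + n} \<or> y = 0 \<and> x \<in> {p<..p + n} \<or>
    x \<in> insert p {p + n<..p + n + m} \<and> y \<in> insert p {p + n<..p + n + m} \<and> x \<noteq> y"
  unfolding sparkler_clique_def Let_def by auto

lemmas sparkler_clique_simps = pverts_sparkler_clique parcs_sparkler_clique_iff

lemma pair_graph_sparkler_clique: "pair_graph (sparkler_clique p n m)"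
proof (rule pair_graphI)
  let ?G = "sparkler_clique p n m"
  show "parcs ?G \<subseteq> pverts ?G \<times> pverts ?G" "sym (parcs ?G)" "irrefl (parcs ?G)"
    by (auto simp: sparkler_clique_simps sym_def irrefl_def)
qed (simp add: sparkler_clique_simps)

lemma connected_sparkler_clique: "Digraph_Component.connected (with_proj (sparkler_clique p n m))"
proof -
  interpret pair_graph "sparkler_clique p n m"
    by (rule pair_graph_sparkler_clique)
  have path: "x \<rightarrow>\<^sup>*\<^bsub>with_proj (sparkler_clique p n m)\<^esub> 0" if "x \<le> p" for x
    using that
  proof (induction x)
    case 0
    then show ?case by (simp add: sparkler_clique_simps)
  next
    case (Suc x)
    then have "(Suc x, x) \<in> parcs (sparkler_clique p n m)"
      by (simp add: sparkler_clique_simps)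
    with Suc show ?case by (auto intro: adj_reachable_trans)
  qed
  show ?thesis
  proof (rule connectedI_reachable)
    show "0 \<in> pverts (sparkler_clique p n m)"
      by (simp add: sparkler_clique_simps)
    fix x assume "x \<in> pverts (sparkler_clique p n m)"
    then consider (path_vertex) "x \<le> p" | (leaf) "x \<in> {p<..p + n}"
      | (clique_vertex) "x \<in> {p + n<..p + n + m}"
      by (fastforce simp: sparkler_clique_simps)
    then show "x \<rightarrow>\<^sup>*\<^bsub>with_proj (sparkler_clique p n m)\<^esub> 0"
    proof cases
      case path_vertex
      then show ?thesis by (rule path)
    next
      case leaf
      then have "(x, 0) \<in> parcs (sparkler_clique p n m)"
        by (simp add: sparkler_clique_simps)
      then show ?thesis by auto
    next
      case clique_vertex
      then have "(x, p) \<in> parcs (sparkler_clique p n m)"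
        by (simp add: sparkler_clique_simps)
      then show ?thesis using path[of p] by (auto intro: adj_reachable_trans)
    qed
  qed
qed

lemma closed_twins_sparkler_clique: "closed_twins (sparkler_clique p n m) {p + n<..p + n + m}"
proof -
  have "insert x (neighbours (sparkler_clique p n m) x) = insert p {p + n<..p + n + m}"
    if "x \<in> {p + n<..p + n + m}" for x
    using that by (auto simp: sparkler_clique_simps)
  then show ?thesis
    by (auto simp: closed_twins_def pverts_sparkler_clique)
qed

lemma induced_subgraph_sparkler_clique:
  assumes "m \<le> m'"
  shows "induced_subgraph (with_proj (sparkler_clique p n m)) (with_proj (sparkler_clique p n m'))"
proof (rule induced_subgraphI)
  let ?H = "sparkler_clique p n m" and ?G = "sparkler_clique p n m'"
  interpret G: pair_graph ?G
    by (rule pair_graph_sparkler_clique)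
  interpret H: pair_graph ?H
    by (rule pair_graph_sparkler_clique)
  have "(x, y) \<in> parcs ?H \<longleftrightarrow> (x, y) \<in> parcs ?G \<and> x \<in> pverts ?H \<and> y \<in> pverts ?H" for x y
  proof (cases "x \<in> pverts ?H \<and> y \<in> pverts ?H")
    case True
    then have "z \<in> insert p {p + n<..p + n + m} \<longleftrightarrow> z \<in> insert p {p + n<..p + n + m'}"
      if "z \<in> {x, y}" for z
      using that assms by (auto simp: pverts_sparkler_clique)
    with True show ?thesis
      unfolding parcs_sparkler_clique_iff by blast
  next
    case False
    then show ?thesis
      using H.wellformed' by blast
  qed
  then show arcs: "arcs (with_proj ?H) = {e \<in> arcs (with_proj ?G).
      tail (with_proj ?G) e \<in> verts (with_proj ?H) \<and> head (with_proj ?G) e \<in> verts (with_proj ?H)}"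
    by auto
  show "subgraph (with_proj ?H) (with_proj ?G)"
    using assms arcs G.wf_digraph H.wf_digraph
    by (auto simp: subgraph_def compatible_def pverts_sparkler_clique)
qed

lemma models_sparkler_clique_iff:
  assumes "sentence \<phi>" and "card (vars \<phi>) \<le> m" and "m \<le> m'"
  shows "models (sparkler_clique p n m') \<phi> \<longleftrightarrow> models (sparkler_clique p n m) \<phi>"
proof (rule closed_twins_models_iff)
  let ?T = "{p + n<..p + n + m'}" and ?H = "sparkler_clique p n m"
  show "pverts (sparkler_clique p n m') - pverts ?H \<subseteq> ?T"
    by (auto simp: pverts_sparkler_clique)
  have "?T \<inter> pverts ?H = {p + n<..p + n + m}"
    using assms(3) by (auto simp: pverts_sparkler_clique)
  then show "card (vars \<phi>) \<le> card (?T \<inter> pverts ?H)"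
    using assms(2) by simp
qed (use pair_graph_sparkler_clique closed_twins_sparkler_clique
    induced_subgraph_sparkler_clique assms in auto)

lemma ex_embedding_sparkler_clique_if_card_le:
  assumes "pair_graph F" and "card (pverts F) \<le> m"
  shows "\<exists>f. embedding f F (sparkler_clique p n m)"
proof -
  interpret F: pair_graph F by fact
  let ?K = "{p + n<..p + n + m}"
  obtain f where f: "f ` pverts F \<subseteq> ?K" "inj_on f (pverts F)"
    using card_le_inj[of "pverts F" ?K] assms(2) by auto
  have "(f u, f v) \<in> parcs (sparkler_clique p n m)" if "(u, v) \<in> parcs F" for u v
  proof -
    have "f u \<in> ?K" "f v \<in> ?K" "f u \<noteq> f v"
      using f F.wellformed'[OF that] F.no_loops'[OF that] by (auto dest: inj_onD)
    then show ?thesis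
      by (simp add: parcs_sparkler_clique_iff)
  qed
  moreover have "f ` pverts F \<subseteq> pverts (sparkler_clique p n m)"
    using f(1) by (auto simp: pverts_sparkler_clique)
  ultimately show ?thesis
    using f(2) unfolding embedding_def by blast
qed

lemma ex_embedding_sparkler_clique_if_defines:
  assumes F: "pair_graph F" and \<phi>: "sentence \<phi>" "defines_asymptotically \<phi> (graphs_containing F)"
  shows "\<exists>N. \<forall>p n. N \<le> p + n \<longrightarrow> (\<exists>f. embedding f F (sparkler_clique p n (card (vars \<phi>))))"
proof -
  obtain N where N: "\<And>G. pair_graph G \<Longrightarrow> Digraph_Component.connected (with_proj G) \<Longrightarrow>
      N \<le> card (pverts G) \<Longrightarrow> models G \<phi> \<longleftrightarrow> G \<in> graphs_containing F"
    using \<phi>(2) unfolding defines_asymptotically_def by blast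
  have models: "models (sparkler_clique p n m) \<phi> \<longleftrightarrow> (\<exists>f. embedding f F (sparkler_clique p n m))"
    if "N \<le> p + n" for p n m
    using N[OF pair_graph_sparkler_clique connected_sparkler_clique] that
    by (simp add: pverts_sparkler_clique pair_graph_sparkler_clique
        graphs_containing_iff_embedding[OF F])
  have "\<exists>f. embedding f F (sparkler_clique p n (card (vars \<phi>)))" if "N \<le> p + n" for p n
    using ex_embedding_sparkler_clique_if_card_le[OF F, of "card (vars \<phi>) + card (pverts F)" p n]
      models_sparkler_clique_iff[OF \<phi>(1) order_refl le_add1, of p n "card (pverts F)"]
    by (simp add: models[OF that])
  then show ?thesis by blast
qed

lemma out_degree_sparkler_clique_no_leaves_le:
  assumes "1 \<le> m"
  shows "out_degree (with_proj (sparkler_clique p 0 m)) x \<le> m + 1"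
proof -
  consider (path_vertex) "x < p" | (tail_end) "x = p" | (clique_vertex) "p < x" by linarith
  then obtain S where "neighbours (sparkler_clique p 0 m) x \<subseteq> S" "finite S" "card S \<le> m + 1"
  proof cases
    case path_vertex
    have "neighbours (sparkler_clique p 0 m) x \<subseteq> {x - 1, Suc x}"
      using path_vertex by (auto simp: parcs_sparkler_clique_iff)
    moreover have "card {x - 1, Suc x} \<le> m + 1"
      using assms by (simp add: card_insert_if)
    ultimately show ?thesis using that by blast
  next
    case tail_end
    have "neighbours (sparkler_clique p 0 m) x \<subseteq> insert (p - 1) {p<..p + m}"
      using tail_end by (auto simp: parcs_sparkler_clique_iff)
    moreover have "card (insert (p - 1) {p<..p + m}) \<le> m + 1"
      by (simp add: card_insert_if)
    ultimately show ?thesis using that by blast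
  next
    case clique_vertex
    have "neighbours (sparkler_clique p 0 m) x \<subseteq> {p..p + m}"
      using clique_vertex by (auto simp: parcs_sparkler_clique_iff)
    then show ?thesis using that by simp
  qed
  then show ?thesis
    unfolding out_degree_eq_card_neighbours by (meson card_mono order_trans)
qed

lemma out_degree_le_card_vars:
  assumes F: "pair_graph F" and \<phi>: "sentence \<phi>" "defines_asymptotically \<phi> (graphs_containing F)"
  shows "out_degree (with_proj F) u \<le> card (vars \<phi>) + 1"
proof -
  interpret F: pair_graph F by fact
  obtain N f where f: "embedding f F (sparkler_clique N 0 (card (vars \<phi>)))"
    using ex_embedding_sparkler_clique_if_defines[OF assms] by (metis add_0_right order_refl)
  interpret H: pair_graph "sparkler_clique N 0 (card (vars \<phi>))"
    by (rule pair_graph_sparkler_clique)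
  have "out_degree (with_proj F) u \<le>
      out_degree (with_proj (sparkler_clique N 0 (card (vars \<phi>)))) (f u)"
    using F.pair_wf_digraph H.pair_fin_digraph f by (rule embedding_out_degree_le)
  also have "\<dots> \<le> card (vars \<phi>) + 1"
    using card_vars_pos by (rule out_degree_sparkler_clique_no_leaves_le)
  finally show ?thesis .
qed

section \<open>Pendant sparklers\<close>

lemma pair_wf_digraph_sparkler: "pair_wf_digraph (sparkler q p)"
  by unfold_locales (auto simp: sparkler_def Let_def image_iff)

lemma (in pair_fin_digraph) finite_pendant_sparkler_tails:
  "finite {p. \<exists>v S q. pendant_sparkler G v S q p}"
proof (rule finite_subset)
  show "{p. \<exists>v S q. pendant_sparkler G v S q p} \<subseteq> {..card (pverts G)}"
  proof safe
    fix v S q p assume "pendant_sparkler G v S q p"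
    then obtain C hom where v: "v \<in> pverts G" and C: "C \<in> pre_digraph.sccs_verts (del_vert v)"
      and S: "S = with_proj G \<restriction> insert v C" and hom: "app_iso hom S = with_proj (sparkler q p)"
      unfolding pendant_sparkler_def branches_def by blast
    have "C \<subseteq> verts (del_vert v)"
      by (rule wf_digraph.sccs_verts_subsets[OF wf_digraph_del_vert C])
    then have "verts S \<subseteq> pverts G"
      using v S by (auto simp: verts_del_vert)
    moreover have "Path ` {1..p} \<subseteq> iso_verts hom ` verts S"
      using arg_cong[OF hom, of verts] by (auto simp: sparkler_def Let_def)
    ultimately have "card (Path ` {1..p}) \<le> card (pverts G)"
      by (intro surj_card_le[OF pair_finite_verts]) blast
    then show "p \<le> card (pverts G)"
      by (simp add: card_image inj_on_def)
  qed
qed simp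

lemma (in pair_fin_digraph) pendant_sparkler_le_sp:
  assumes "pendant_sparkler G v S q p"
  shows "p \<le> sp G"
  unfolding sp_def using finite_pendant_sparkler_tails by (rule Max_ge) (use assms in blast)

text \<open>The star with centre \<open>w 0\<close> and leaves \<open>L\<close>, together with the path \<open>w 0, \<dots>, w t\<close>, is a sparkler
  with tail end \<open>w t\<close>, and only the tail end may have further neighbours.\<close>

locale tailed_sparkler = pair_graph F for F :: "'a pair_pre_digraph" +
  fixes L :: "'a set" and w :: "nat \<Rightarrow> 'a" and t :: nat
  assumes tail_pos: "1 \<le> t"
    and inj_path: "inj_on w {..t}"
    and path_not_leaf: "i \<le> t \<Longrightarrow> w i \<notin> L"
    and neighbours_leaf: "x \<in> L \<Longrightarrow> neighbours F x = {w 0}"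
    and neighbours_center: "neighbours F (w 0) = insert (w 1) L"
    and neighbours_path: "0 < i \<Longrightarrow> i < t \<Longrightarrow> neighbours F (w i) = {w (i - 1), w (Suc i)}"
begin

lemma path_eq_iff: "i \<le> t \<Longrightarrow> j \<le> t \<Longrightarrow> w i = w j \<longleftrightarrow> i = j"
  using inj_path by (auto dest: inj_onD)

lemma leaf_arc: "x \<in> L \<Longrightarrow> (x, w 0) \<in> parcs F"
  using neighbours_leaf by auto

lemma path_arc: "i < t \<Longrightarrow> (w i, w (Suc i)) \<in> parcs F"
  using neighbours_center neighbours_path[of i] by (cases "i = 0") auto

lemma leaves_subset: "L \<subseteq> pverts F"
  using leaf_arc in_arcsD1 by blast

lemma path_in_verts: "i \<le> t \<Longrightarrow> w i \<in> pverts F"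
  using path_arc[of i] path_arc[of "t - 1"] tail_pos in_arcsD1 in_arcsD2 by (cases "i = t") auto

definition interior :: "'a set" where
  "interior = L \<union> w ` {..<t}"

definition sparkler_verts :: "'a set" where
  "sparkler_verts = L \<union> w ` {..t}"

definition sparkler_arcs :: "('a \<times> 'a) set" where
  "sparkler_arcs = {w 0} \<times> L \<union> {(w i, w (Suc i)) | i. i < t}"

lemma arc_from_interior:
  assumes "(u, v) \<in> parcs F" and "u \<in> interior"
  shows "(u, v) \<in> sparkler_arcs \<union> sparkler_arcs\<inverse>"
proof -
  have v: "v \<in> neighbours F u"
    using assms(1) by simp
  consider (leaf) "u \<in> L" | (center) "u = w 0" | (path_vertex) i where "u = w (Suc i)" "Suc i < t"
    using assms(2) by (auto simp: interior_def image_iff) (metis not0_implies_Suc)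
  then show ?thesis
  proof cases
    case leaf
    then show ?thesis
      using v neighbours_leaf by (auto simp: sparkler_arcs_def)
  next
    case center
    then have "v = w (Suc 0) \<or> v \<in> L"
      using v neighbours_center by auto
    then show ?thesis
      using center tail_pos by (auto simp: sparkler_arcs_def)
  next
    case path_vertex
    then have "v = w i \<or> v = w (Suc (Suc i))"
      using v neighbours_path[of "Suc i"] by auto
    then show ?thesis
      using path_vertex by (fastforce simp: sparkler_arcs_def)
  qed
qed

lemma arc_to_tail_end:
  assumes "(w i, w t) \<in> parcs F" and "i < t"
  shows "i = t - 1"
proof -
  have "(w i, w t) \<in> sparkler_arcs \<union> sparkler_arcs\<inverse>"
    using assms by (intro arc_from_interior) (auto simp: interior_def)
  then consider "w t \<in> L" | "w t = w 0" | j where "w i = w j" "w t = w (Suc j)" "j < t"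
    | j where "w t = w j" "j < t"
    by (auto simp: sparkler_arcs_def)
  then show ?thesis
    using assms(2) path_not_leaf[of t] by cases (auto simp: path_eq_iff)
qed

lemma sparkler_verts_eq: "sparkler_verts = insert (w t) interior"
  by (auto simp: sparkler_verts_def interior_def lessThan_Suc_atMost[symmetric] lessThan_Suc)

lemma parcs_induced:
  "parcs F \<inter> sparkler_verts \<times> sparkler_verts = sparkler_arcs \<union> sparkler_arcs\<inverse>"
proof
  have "sparkler_arcs \<subseteq> parcs F"
    using leaf_arc path_arc arcs_symmetric by (auto simp: sparkler_arcs_def)
  moreover have "sparkler_arcs \<subseteq> sparkler_verts \<times> sparkler_verts"
    by (auto simp: sparkler_arcs_def sparkler_verts_def)
  ultimately show "sparkler_arcs \<union> sparkler_arcs\<inverse> \<subseteq> parcs F \<inter> sparkler_verts \<times> sparkler_verts"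
    using arcs_symmetric by blast
next
  have "(u, v) \<in> sparkler_arcs \<union> sparkler_arcs\<inverse>"
    if arc: "(u, v) \<in> parcs F" and "u \<in> sparkler_verts" "v \<in> sparkler_verts" for u v
  proof -
    have "u \<in> interior \<or> v \<in> interior"
      using that no_loops'[OF arc] by (auto simp: sparkler_verts_eq)
    then show ?thesis
      using arc_from_interior[OF arc] arc_from_interior[OF arcs_symmetric[OF arc]] by blast
  qed
  then show "parcs F \<inter> sparkler_verts \<times> sparkler_verts \<subseteq> sparkler_arcs \<union> sparkler_arcs\<inverse>"
    by auto
qed

lemma arcs_ends_del_tail_end:
  "(u, v) \<in> arcs_ends (del_vert (w t)) \<longleftrightarrow> (u, v) \<in> parcs F \<and> u \<noteq> w t \<and> v \<noteq> w t"
  by (auto simp: arcs_ends_conv del_vert_simps image_iff)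

lemma center_in_verts_del_tail_end: "w 0 \<in> verts (del_vert (w t))"
  using path_in_verts[of 0] path_eq_iff[of 0 t] tail_pos by (auto simp: verts_del_vert)

lemma interior_reaches_center:
  assumes "u \<in> interior"
  shows "u \<rightarrow>\<^sup>*\<^bsub>del_vert (w t)\<^esub> w 0"
proof -
  interpret D: wf_digraph "del_vert (w t)"
    by (rule wf_digraph_del_vert)
  have "w i \<rightarrow>\<^sup>*\<^bsub>del_vert (w t)\<^esub> w 0" if "i < t" for i
    using that
  proof (induction i)
    case 0
    show ?case
      using center_in_verts_del_tail_end by simp
  next
    case (Suc i)
    then have "(w (Suc i), w i) \<in> arcs_ends (del_vert (w t))"
      using arcs_symmetric[OF path_arc[of i]] path_eq_iff[of _ t]
      by (auto simp: arcs_ends_del_tail_end)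
    then show ?case
      using Suc D.adj_reachable_trans by auto
  qed
  moreover have "(x, w 0) \<in> arcs_ends (del_vert (w t))" if "x \<in> L" for x
    using that leaf_arc path_eq_iff[of 0 t] tail_pos path_not_leaf[of t]
    by (auto simp: arcs_ends_del_tail_end)
  ultimately show ?thesis
    using assms D.reachable_adjI unfolding interior_def by blast
qed

lemma interior_closed:
  assumes "(u, v) \<in> parcs F" and "u \<in> interior" and "v \<noteq> w t"
  shows "v \<in> interior"
proof -
  have "(u, v) \<in> sparkler_arcs \<union> sparkler_arcs\<inverse>"
    using assms(1,2) by (rule arc_from_interior)
  then consider "v \<in> L" | "v = w 0" | i where "v = w i" "i < t"
    | (next_path_vertex) i where "v = w (Suc i)" "i < t"
    by (auto simp: sparkler_arcs_def)
  then show ?thesis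
  proof cases
    case next_path_vertex
    with assms(3) have "Suc i < t"
      by (cases "Suc i = t") auto
    with next_path_vertex show ?thesis by (auto simp: interior_def)
  qed (use tail_pos in \<open>auto simp: interior_def\<close>)
qed

lemma interior_in_sccs_verts: "interior \<in> pre_digraph.sccs_verts (del_vert (w t))"
proof -
  interpret D: wf_digraph "del_vert (w t)"
    by (rule wf_digraph_del_vert)
  show ?thesis
  proof (rule D.in_sccs_vertsI_closed[OF _ _ center_in_verts_del_tail_end interior_reaches_center])
    show "symmetric (del_vert (w t))"
      by (auto simp: symmetric_def sym_def arcs_ends_del_tail_end intro: arcs_symmetric)
    show "w 0 \<in> interior"
      using tail_pos by (auto simp: interior_def)
    show "v \<in> interior"
      if "u \<in> interior" "(u, v) \<in> arcs_ends (del_vert (w t))" for u v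
      using that interior_closed[of u v] by (simp add: arcs_ends_del_tail_end)
  qed
qed

lemma finite_leaves: "finite L"
  using leaves_subset pair_finite_verts by (rule finite_subset)

text \<open>The isomorphism from the abstract sparkler, where \<open>e\<close> enumerates the leaves.\<close>

definition vertex_of :: "(nat \<Rightarrow> 'a) \<Rightarrow> sparkler_vertex \<Rightarrow> 'a" where
  "vertex_of e = case_sparkler_vertex (w 0) e w"

lemma vertex_of_simps [simp]:
  "vertex_of e Center = w 0"
  "vertex_of e (Leaf i) = e i"
  "vertex_of e (Path i) = w i"
  by (simp_all add: vertex_of_def)

lemma map_sparkler_verts:
  assumes "e ` {1..card L} = L"
  shows "vertex_of e ` pverts (sparkler (card L + 1) t) = sparkler_verts"
proof -
  have "pverts (sparkler (card L + 1) t) = {Center} \<union> Leaf ` {1..card L} \<union> Path ` {1..t}"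
    by (simp add: sparkler_def Let_def)
  then have "vertex_of e ` pverts (sparkler (card L + 1) t) = {w 0} \<union> L \<union> w ` {1..t}"
    using assms by (simp add: image_Un image_image)
  also have "\<dots> = L \<union> w ` insert 0 {1..t}"
    by auto
  also have "insert 0 {1..t} = {..t}"
    by auto
  finally show ?thesis
    by (simp only: sparkler_verts_def)
qed

lemma map_sparkler_arcs:
  assumes "e ` {1..card L} = L"
  shows "map_prod (vertex_of e) (vertex_of e) ` parcs (sparkler (card L + 1) t) =
    sparkler_arcs \<union> sparkler_arcs\<inverse>"
proof -
  let ?A = "{(Center, Leaf i) | i. i \<in> {1..card L}} \<union> {(Center, Path i) | i. i = 1 \<and> i \<le> t} \<union>
    {(Path i, Path (i + 1)) | i. 1 \<le> i \<and> i + 1 \<le> t}"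
  let ?g = "map_prod (vertex_of e) (vertex_of e)"
  have "?g ` {(Center, Leaf i) | i. i \<in> {1..card L}} = {w 0} \<times> e ` {1..card L}"
    by force
  moreover have "?g ` {(Center, Path i) | i. i = 1 \<and> i \<le> t} = {(w 0, w 1)}"
    using tail_pos by auto
  moreover have "?g ` {(Path i, Path (i + 1)) | i. 1 \<le> i \<and> i + 1 \<le> t} =
      {(w i, w (Suc i)) | i. 1 \<le> i \<and> i < t}"
    by force
  moreover have
    "{(w 0, w 1)} \<union> {(w i, w (Suc i)) | i. 1 \<le> i \<and> i < t} = {(w i, w (Suc i)) | i. i < t}"
    using tail_pos by (auto simp: Suc_le_eq)
  ultimately have "?g ` ?A = sparkler_arcs"
    unfolding sparkler_arcs_def by (simp only: image_Un Un_assoc assms)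
  moreover have "?g ` (?A\<inverse>) = (?g ` ?A)\<inverse>"
    by (auto simp: image_iff)
  moreover have "parcs (sparkler (card L + 1) t) = ?A \<union> ?A\<inverse>"
    by (simp add: sparkler_def Let_def)
  ultimately show ?thesis
    by (simp only: image_Un)
qed

lemma inj_on_vertex_of:
  assumes "bij_betw e {1..card L} L"
  shows "inj_on (vertex_of e) (pverts (sparkler (card L + 1) t))"
proof (rule inj_onI)
  have e: "e i \<in> L" if "i \<in> {1..card L}" for i
    using assms that by (auto simp: bij_betw_def)
  have e_path: "e i \<noteq> w j" "w j \<noteq> e i" if "i \<in> {1..card L}" "j \<le> t" for i j
    using e[OF that(1)] path_not_leaf[OF that(2)] by auto
  have e_eq_iff: "e i = e j \<longleftrightarrow> i = j" if "i \<in> {1..card L}" "j \<in> {1..card L}" for i j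
    using assms that by (auto simp: bij_betw_def dest: inj_onD)
  fix a b
  assume "a \<in> pverts (sparkler (card L + 1) t)" "b \<in> pverts (sparkler (card L + 1) t)"
    "vertex_of e a = vertex_of e b"
  then show "a = b"
    by (auto simp: sparkler_def Let_def e_path e_eq_iff path_eq_iff)
qed

lemma induced_isomorphism_sparkler:
  obtains hom where "pre_digraph.digraph_isomorphism (with_proj F \<restriction> sparkler_verts) hom"
    and "app_iso hom (with_proj F \<restriction> sparkler_verts) = with_proj (sparkler (card L + 1) t)"
    and "iso_verts hom (w t) = tail_end t"
proof -
  let ?S = "sparkler (card L + 1) t"
  interpret S: pair_wf_digraph ?S
    by (rule pair_wf_digraph_sparkler)
  obtain e where e: "bij_betw e {1..card L} L"
    using ex_bij_betw_nat_finite_1[OF finite_leaves] by blast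
  let ?h = "vertex_iso (vertex_of e)"
  have iso: "S.digraph_isomorphism ?h"
    using inj_on_vertex_of[OF e] by (rule S.digraph_isomorphism_vertex_iso)
  have "map_graph (vertex_of e) ?S =
      \<lparr> pverts = sparkler_verts, parcs = sparkler_arcs \<union> sparkler_arcs\<inverse> \<rparr>"
    using e by (simp only: map_graph_def map_sparkler_verts map_sparkler_arcs bij_betw_def)
  then have "with_proj F \<restriction> sparkler_verts = with_proj (map_graph (vertex_of e) ?S)"
    unfolding parcs_induced[symmetric] by (auto simp: induce_subgraph_def with_proj_def)
  then have app: "with_proj F \<restriction> sparkler_verts = app_iso ?h (with_proj ?S)"
    by (simp add: app_iso_vertex_iso)
  have "tail_end t \<in> pverts ?S"
    using tail_pos by (simp add: tail_end_def sparkler_def Let_def)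
  then have "iso_verts (S.inv_iso ?h) (w t) = tail_end t"
    using S.iso_verts_inv_iso[OF iso, of "tail_end t"] tail_pos
    by (simp add: iso_verts_vertex_iso tail_end_def)
  then show thesis
    using that S.digraph_isomorphism_invI[OF iso] S.app_iso_inv[OF iso] unfolding app by blast
qed

lemma pendant_sparkler_tail_end:
  assumes "2 \<le> card L"
    and "3 \<le> out_degree (with_proj F) (w t) \<or> out_degree (with_proj F) (w t) = 1"
  shows "pendant_sparkler F (w t) (with_proj F \<restriction> sparkler_verts) (card L + 1) t"
proof -
  have "with_proj F \<restriction> sparkler_verts \<in> branches F (w t)"
    using interior_in_sccs_verts sparkler_verts_eq unfolding branches_def by auto
  moreover obtain hom where "pre_digraph.digraph_isomorphism (with_proj F \<restriction> sparkler_verts) hom"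
    "app_iso hom (with_proj F \<restriction> sparkler_verts) = with_proj (sparkler (card L + 1) t)"
    "iso_verts hom (w t) = tail_end t"
    by (rule induced_isomorphism_sparkler)
  ultimately show ?thesis
    using assms path_in_verts[of t] unfolding pendant_sparkler_def by auto
qed

lemma tailed_sparkler_extend:
  assumes "out_degree (with_proj F) (w t) = 2"
  shows "\<exists>w'. tailed_sparkler F L w' (Suc t)"
proof -
  have pred: "w (t - 1) \<in> neighbours F (w t)"
    using arcs_symmetric[OF path_arc[of "t - 1"]] tail_pos by simp
  moreover have "card (neighbours F (w t)) = 2"
    using assms by (simp add: out_degree_eq_card_neighbours)
  ultimately have "card (neighbours F (w t) - {w (t - 1)}) = 1"
    by simp
  then obtain u where "neighbours F (w t) - {w (t - 1)} = {u}"
    by (rule card_1_singletonE)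
  then have u: "u \<noteq> w (t - 1)" and N: "neighbours F (w t) = {w (t - 1), u}"
    using pred by auto
  have arc: "(u, w t) \<in> parcs F"
    using N arcs_symmetric_iff by blast
  then have "w t \<in> neighbours F u" by simp
  then have "u \<notin> L"
    using neighbours_leaf[of u] path_eq_iff[of t 0] tail_pos by force
  moreover have u_path: "u \<noteq> w i" if "i \<le> t" for i
    using arc u that arc_to_tail_end[of i] no_loops'[OF arc] by (cases "i = t") auto
  moreover have "inj_on (w(Suc t := u)) {..Suc t}"
    using inj_path u_path by (auto simp: atMost_Suc inj_on_def)
  moreover have "neighbours F (w i) = {w (i - 1), (w(Suc t := u)) (Suc i)}"
    if "0 < i" "i < Suc t" for i
    using neighbours_path[of i] N that by (cases "i = t") auto
  ultimately have "tailed_sparkler F L (w(Suc t := u)) (Suc t)"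
    using tail_pos path_not_leaf neighbours_leaf neighbours_center
    by unfold_locales (auto simp: le_Suc_eq)
  then show ?thesis by blast
qed

lemma tail_le_card_verts: "t \<le> card (pverts F)"
proof -
  have "card {..t} \<le> card (pverts F)"
    using inj_path path_in_verts pair_finite_verts by (intro card_inj_on_le) auto
  then show ?thesis by simp
qed

end

lemma tailed_sparkler_le_sp:
  assumes "tailed_sparkler F L w t" and "2 \<le> card L"
  shows "t \<le> sp F"
  using assms(1)
proof (induction "card (pverts F) - t" arbitrary: w t rule: less_induct)
  case less
  interpret tailed_sparkler F L w t by fact
  show ?case
  proof (cases "out_degree (with_proj F) (w t) = 2")
    case True
    then obtain w' where w': "tailed_sparkler F L w' (Suc t)"
      using tailed_sparkler_extend by blast
    then have "Suc t \<le> sp F"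
      using less.hyps tailed_sparkler.tail_le_card_verts[OF w'] by simp
    then show ?thesis by simp
  next
    case False
    have "w (t - 1) \<in> neighbours F (w t)"
      using arcs_symmetric[OF path_arc[of "t - 1"]] tail_pos by simp
    then have "out_degree (with_proj F) (w t) \<noteq> 0"
      unfolding out_degree_eq_card_neighbours by (metis card_0_eq empty_iff finite_neighbours)
    then have "3 \<le> out_degree (with_proj F) (w t) \<or> out_degree (with_proj F) (w t) = 1"
      using False by linarith
    then show ?thesis
      using pendant_sparkler_tail_end[OF assms(2)] by (intro pendant_sparkler_le_sp)
  qed
qed

section \<open>Embeddings into a sparkler with a clique\<close>

locale sparkler_clique_embedding = pair_graph F for F :: "'a pair_pre_digraph" +
  fixes f :: "'a \<Rightarrow> nat" and p n m :: nat
  assumes connected_F: "Digraph_Component.connected (with_proj F)"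
    and embedding: "embedding f F (sparkler_clique p n m)"
    and path_pos: "1 \<le> p"
begin

definition leaves :: "'a set" where
  "leaves = {u \<in> pverts F. f u \<in> {p<..p + n}}"

definition preimage :: "nat \<Rightarrow> 'a" where
  "preimage = the_inv_into (pverts F) f"

lemma inj_f: "inj_on f (pverts F)"
  using embedding by (simp add: embedding_def)

lemma finite_leaves: "finite leaves"
  by (simp add: leaves_def pair_finite_verts)

lemma preimage_f: "u \<in> pverts F \<Longrightarrow> preimage (f u) = u"
  unfolding preimage_def using inj_f by (rule the_inv_into_f_f)

lemma arc_image: "(u, v) \<in> parcs F \<Longrightarrow> (f u, f v) \<in> parcs (sparkler_clique p n m)"
  using embedding by (rule embedding_arc)

lemma card_verts_le_card_leaves:
  assumes "f ` (pverts F - leaves) \<subseteq> S" and "finite S"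
  shows "card (pverts F) \<le> card leaves + card S"
proof -
  have "card (pverts F - leaves) \<le> card S"
    using inj_f assms by (intro card_inj_on_le[of f]) (auto intro: inj_on_subset)
  moreover have "card (pverts F) \<le> card leaves + card (pverts F - leaves)"
    using finite_leaves by (simp add: card_Diff_subset leaves_def)
  ultimately show ?thesis by simp
qed

lemma card_verts_le: "card (pverts F) \<le> card leaves + (p + 1 + m)"
proof -
  have "f ` (pverts F - leaves) \<subseteq> {..p} \<union> {p + n<..p + n + m}"
    using embedding by (auto simp: leaves_def embedding_def pverts_sparkler_clique)
  then have "card (pverts F) \<le> card leaves + card ({..p} \<union> {p + n<..p + n + m})"
    by (rule card_verts_le_card_leaves) simp
  also have "card ({..p} \<union> {p + n<..p + n + m}) = p + 1 + m"
    by (subst card_Un_disjoint) auto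
  finally show ?thesis .
qed

lemma neighbours_leaf:
  assumes "2 \<le> card (pverts F)" and "x \<in> leaves"
  shows "neighbours F x = {preimage 0}"
proof -
  have x: "x \<in> pverts F" "f x \<in> {p<..p + n}"
    using assms(2) by (auto simp: leaves_def)
  have "\<not> pverts F \<subseteq> {x}"
    using assms(1) card_mono[of "{x}" "pverts F"] by auto
  then obtain y where "y \<in> pverts F" "y \<notin> {x}" by blast
  then obtain v where "(x, v) \<in> parcs F"
    using connected_crossing_arc[OF connected_F, of x "{x}" y] x(1) by auto
  moreover have "u = preimage 0" if "(x, u) \<in> parcs F" for u
  proof -
    have "f u = 0"
      using arc_image[OF that] x(2) path_pos by (auto simp: parcs_sparkler_clique_iff)
    then show ?thesis
      using preimage_f[OF in_arcsD2[OF that]] by simp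
  qed
  ultimately show ?thesis by blast
qed

text \<open>The only edge of the host leaving the leaves and the first \<open>i\<close> path vertices is the next
  path edge.\<close>

lemma path_arc:
  assumes "leaves \<noteq> {}" and "z \<in> pverts F - leaves" and "i < f z" and "i < p"
  shows "{i, Suc i} \<subseteq> f ` pverts F" and "(preimage i, preimage (Suc i)) \<in> parcs F"
proof -
  let ?A = "{u \<in> pverts F. f u \<le> i} \<union> leaves"
  obtain x where "x \<in> leaves"
    using assms(1) by blast
  moreover have "z \<notin> ?A"
    using assms(2,3) by auto
  ultimately obtain u v where uv: "(u, v) \<in> parcs F" "u \<in> ?A" "v \<notin> ?A"
    using connected_crossing_arc[OF connected_F, of x ?A z] assms(2) by (auto simp: leaves_def)
  have verts: "u \<in> pverts F" "v \<in> pverts F"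
    using uv(1) by (rule wellformed')+
  then have f: "f u = i" "f v = Suc i"
    using arc_image[OF uv(1)] uv(2,3) assms(4) by (auto simp: leaves_def parcs_sparkler_clique_iff)
  then show "{i, Suc i} \<subseteq> f ` pverts F"
    using verts by force
  show "(preimage i, preimage (Suc i)) \<in> parcs F"
    using uv(1) preimage_f verts f by metis
qed

lemma card_verts_le_if_end_unused:
  assumes "leaves \<noteq> {}" and "p \<notin> f ` pverts F"
  shows "card (pverts F) \<le> card leaves + p"
proof -
  have "f u < p" if "u \<in> pverts F - leaves" for u
  proof (rule ccontr)
    assume "\<not> f u < p"
    then have "p - 1 < f u"
      using path_pos by simp
    then show False
      using path_arc(1)[OF assms(1) that, of "p - 1"] path_pos assms(2) by simp
  qed
  then show ?thesis
    using card_verts_le_card_leaves[of "{..<p}"] by auto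
qed

lemma card_leaves_le_out_degree:
  assumes "2 \<le> card (pverts F)"
  shows "card leaves \<le> out_degree (with_proj F) (preimage 0)"
proof -
  have "leaves \<subseteq> neighbours F (preimage 0)"
    using neighbours_leaf[OF assms] arcs_symmetric by blast
  then show ?thesis
    unfolding out_degree_eq_card_neighbours by (rule card_mono[OF finite_neighbours])
qed

context
  assumes end_used: "p \<in> f ` pverts F" and leaves_nonempty: "leaves \<noteq> {}"
begin

lemma path_arc_if_end_used:
  assumes "i < p"
  shows "{i, Suc i} \<subseteq> f ` pverts F" and "(preimage i, preimage (Suc i)) \<in> parcs F"
proof -
  obtain z where z: "z \<in> pverts F - leaves" "i < f z"
    using end_used assms by (auto simp: leaves_def)
  show "{i, Suc i} \<subseteq> f ` pverts F" "(preimage i, preimage (Suc i)) \<in> parcs F"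
    by (fact path_arc[OF leaves_nonempty z assms])+
qed

lemma f_preimage: "i \<le> p \<Longrightarrow> f (preimage i) = i"
  using end_used path_arc_if_end_used(1)[of i] preimage_f by (cases "i = p") force+

lemma neighbours_center:
  assumes "2 \<le> card (pverts F)"
  shows "neighbours F (preimage 0) = insert (preimage 1) leaves"
proof
  show "insert (preimage 1) leaves \<subseteq> neighbours F (preimage 0)"
    using path_arc_if_end_used(2)[of 0] path_pos neighbours_leaf[OF assms] arcs_symmetric by auto
  show "neighbours F (preimage 0) \<subseteq> insert (preimage 1) leaves"
  proof
    fix u assume "u \<in> neighbours F (preimage 0)"
    then have arc: "(preimage 0, u) \<in> parcs F" by simp
    have u: "u \<in> pverts F"
      using arc by (rule in_arcsD2)
    have "f u = 1 \<or> f u \<in> {p<..p + n}"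
      using arc_image[OF arc] f_preimage[of 0] path_pos
      by (auto simp: parcs_sparkler_clique_iff)
    then show "u \<in> insert (preimage 1) leaves"
      using u preimage_f[OF u] by (auto simp: leaves_def)
  qed
qed

lemma neighbours_path:
  assumes "0 < i" and "i < p"
  shows "neighbours F (preimage i) = {preimage (i - 1), preimage (Suc i)}"
proof
  show "{preimage (i - 1), preimage (Suc i)} \<subseteq> neighbours F (preimage i)"
    using path_arc_if_end_used(2)[of i] arcs_symmetric[OF path_arc_if_end_used(2)[of "i - 1"]] assms
    by simp
  show "neighbours F (preimage i) \<subseteq> {preimage (i - 1), preimage (Suc i)}"
  proof
    fix u assume "u \<in> neighbours F (preimage i)"
    then have arc: "(preimage i, u) \<in> parcs F" by simp
    have "f u = i - 1 \<or> f u = Suc i"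
      using arc_image[OF arc] f_preimage[of i] assms
      by (auto simp: parcs_sparkler_clique_iff)
    then show "u \<in> {preimage (i - 1), preimage (Suc i)}"
      using preimage_f[OF in_arcsD2[OF arc]] by auto
  qed
qed

lemma tailed_sparkler_preimage:
  assumes "2 \<le> card (pverts F)"
  shows "tailed_sparkler F leaves preimage p"
proof
  show "1 \<le> p"
    by (rule path_pos)
  show "inj_on preimage {..p}"
    by (rule inj_on_inverseI[of _ f]) (simp add: f_preimage)
  show "preimage i \<notin> leaves" if "i \<le> p" for i
    using f_preimage[OF that] that by (auto simp: leaves_def)
qed (fact neighbours_leaf[OF assms] neighbours_center[OF assms] neighbours_path)+

end

end

lemma card_verts_le_card_vars_add_sp:
  assumes F: "pair_graph F" and conn: "Digraph_Component.connected (with_proj F)"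
    and \<phi>: "sentence \<phi>" "defines_asymptotically \<phi> (graphs_containing F)"
  shows "card (pverts F) \<le> card (vars \<phi>) + sp F + 3"
proof (rule ccontr)
  let ?k = "card (vars \<phi>)" and ?p = "sp F + 1"
  assume "\<not> ?thesis"
  then have large: "?k + ?p + 2 < card (pverts F)" by simp
  obtain n f where f: "embedding f F (sparkler_clique ?p n ?k)"
    using ex_embedding_sparkler_clique_if_defines[OF F \<phi>] by (metis le_add2)
  interpret sparkler_clique_embedding F f ?p n ?k
    using F conn f by (simp add: sparkler_clique_embedding_def sparkler_clique_embedding_axioms_def)
  have leaves: "2 \<le> card leaves"
    using card_verts_le large by simp
  then have nonempty: "leaves \<noteq> {}" by auto
  have "card leaves \<le> ?k + 1"
    using card_leaves_le_out_degree out_degree_le_card_vars[OF F \<phi>, of "preimage 0"] large by simp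
  then have "?p \<in> f ` pverts F"
    using card_verts_le_if_end_unused[OF nonempty] large by linarith
  then have "tailed_sparkler F leaves preimage ?p"
    using nonempty large by (intro tailed_sparkler_preimage) simp_all
  then have "?p \<le> sp F"
    using leaves by (rule tailed_sparkler_le_sp)
  then show False by simp
qed

theorem lemma8:
  fixes F :: "'a pair_pre_digraph" and l :: nat
  assumes "pair_graph F"
    and "Digraph_Component.connected F"
    and "card (pverts F) = l"
    and "has_pendant_sparkler F"
  shows "int (asymptotic_width F) \<ge> int l - int (sp F) - 3"
proof -
  have "\<exists>k \<phi>. sentence \<phi> \<and> defines_asymptotically \<phi> (graphs_containing F) \<and> card (vars \<phi>) = k"
    using ex_sentence_defining_graphs_containing[OF assms(1)] by blast
  then have "\<exists>\<phi>. sentence \<phi> \<and> defines_asymptotically \<phi> (graphs_containing F) \<and>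
      card (vars \<phi>) = asymptotic_width F"
    unfolding asymptotic_width_def by (rule LeastI_ex)
  then have "l \<le> asymptotic_width F + sp F + 3"
    using card_verts_le_card_vars_add_sp[OF assms(1,2)] assms(3) by metis
  then show ?thesis by linarith
qed

end
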